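(* Let $q$ be an odd prime power, let $\varepsilon=(-1)^{(q-1)/2}\in\{1,-1\}$, and let $m=(q-\varepsilon)/4$ (which is an integer). Then in $\mathbb{F}_q[x]$ we have $$D_m(x) = \prod \left\{\,x-b : b \in \mathbb{F}_q,\ \left(\frac{2-b}{q}\right) = \left(\frac{2+b}{q}\right) = -1 \,\right\}$$ and also $$D_m(x) = \left(\frac{2}{q}\right) \prod \left\{\,b-x : b \in \mathbb{F}_q,\ \left(\frac{2-b}{q}\right) = \left(\frac{2+b}{q}\right) = -1 \,\right\}.$$
   Context: $\mathbb{F}_q$ is the field with $q$ elements. For $a\in\mathbb{F}_q$, the Legendre symbol $\left(\frac{a}{q}\right)\in\mathbb{Z}$ equals $1$, $-1$ or $0$ according as $a$ is a nonzero square in $\mathbb{F}_q$, a nonsquare in $\mathbb{F}_q$, or $0$; when it appears as a factor it is regarded as an element of $\mathbb{F}_q$. The $k$th Dickson polynomial of the first kind $D_k(x)\in\mathbb{Z}[x]$ is defined by $D_0(x)=2$, $D_1(x)=x$, and $D_{k+2}(x)=xD_{k+1}(x)-D_k(x)$ for $k\ge 0$; here it is viewed in $\mathbb{F}_q[x]$ by reducing coefficients. The notation $\prod\{\,g(b) : \ldots\,\}$ denotes the product of $g(b)$ over all $b$ satisfying the stated conditions. *)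

theory Defs
  imports "HOL-Computational_Algebra.Computational_Algebra" "HOL-Number_Theory.Prime_Powers"
begin

(* The library's Legendre symbol only covers the residue fields Z/pZ; here q may be any
   odd prime power, with the field of q elements given as a type. *)
definition finite_Legendre :: "'a::field \<Rightarrow> int" where
  "finite_Legendre a = (if a = 0 then 0 else if is_square a then 1 else - 1)"

(* first kind, with parameter 1 *)
fun Dickson_poly :: "nat \<Rightarrow> int poly" where
  "Dickson_poly 0 = [:2:]"
| "Dickson_poly (Suc 0) = [:0, 1:]"
| "Dickson_poly (Suc (Suc k)) = [:0, 1:] * Dickson_poly (Suc k) - Dickson_poly k"

abbreviation reduce_poly :: "int poly \<Rightarrow> 'a::comm_ring_1 poly" where
  "reduce_poly \<equiv> map_poly of_int"

end

theory Submission
  imports Defs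
begin

text \<open>
  Put \<open>h = (q + 1) / 2\<close>, so that \<open>2 m\<close> is the even one of \<open>h\<close> and \<open>h - 1\<close>, and write \<open>D\<close> for
  \<open>D\<^sub>m\<close> over the field of \<open>q\<close> elements. Everything follows from the single identity
  \[ 2 D^2 = (2 + x)^h + (2 - x)^h + 4 \]
  (\<open>Dickson_square\<close>). To see it, write \<open>x = y + 1/y\<close>. Then \<open>D\<^sub>n(x) = y^n + y^{-n}\<close>, hence
  \<open>D^2 = y^{2m} + y^{-2m} + 2\<close>, while \<open>2 + x = (y + 1)^2 / y\<close> and \<open>2 - x = - (y - 1)^2 / y\<close>, so that
  the two \<open>h\<close>-th powers involve \<open>(y + 1)^{q+1} = (y^q + 1)(y + 1)\<close> and
  \<open>(y - 1)^{q+1} = (y^q - 1)(y - 1)\<close>; the parity of \<open>h\<close> decides which half of the terms cancels.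
  The adjunction of \<open>y\<close> is carried out by computing with polynomials in \<open>y\<close> over the polynomial
  ring in \<open>x\<close>, modulo \<open>y (x - y) - 1\<close>.

  The identity is used three times. By Euler's criterion \<open>a^h\<close> is \<open>a\<close> times the Legendre symbol
  of \<open>a\<close>, so evaluating at \<open>b\<close> shows that the roots of \<open>D\<close> in the field are exactly the \<open>b\<close> for
  which \<open>2 - b\<close> and \<open>2 + b\<close> are both nonsquares. Evaluating at \<open>0\<close>, where \<open>D\<^sub>m\<close> takes
  the value \<open>0\<close> or \<open>\<plusminus>2\<close> according to the parity of \<open>m\<close>, shows that \<open>2\<close> has Legendre symbol
  \<open>(-1)^m\<close>, which turns the first factorisation into the second. Finally, the squares of
  \<open>A = (2 + x)^h\<close> and \<open>B = (2 - x)^h\<close> are \<open>(2 + x)(2 + x^q)\<close> and \<open>(2 - x)(2 - x^q)\<close>, and with these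
  values the product of \<open>A + B + 4\<close> with three conjugates is \<open>16 (x^q - x)^2\<close>. So \<open>D^2\<close> divides
  \<open>(x^q - x)^2\<close>, the square of a product of distinct linear factors, which forces the monic \<open>D\<close>
  to be the product of \<open>x - b\<close> over its roots \<open>b\<close>.
\<close>

section \<open>Congruences in a commutative ring\<close>

text \<open>
  The congruences below take place in polynomials over a polynomial ring, where there is no
  division with remainder, so congruence is expressed by divisibility of the difference.
\<close>

definition congr :: "'r::comm_ring_1 \<Rightarrow> 'r \<Rightarrow> 'r \<Rightarrow> bool" where
  "congr M a b \<longleftrightarrow> M dvd a - b"

lemma congr_refl: "congr M a a"
  by (simp add: congr_def)

lemma congr_sym: "congr M a b \<Longrightarrow> congr M b a"
  unfolding congr_def by (metis dvd_minus_iff minus_diff_eq)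

lemma congr_trans [trans]: "congr M a b \<Longrightarrow> congr M b c \<Longrightarrow> congr M a c"
  unfolding congr_def using dvd_add by fastforce

lemma congr_add:
  assumes "congr M a b" and "congr M c d"
  shows "congr M (a + c) (b + d)"
  using dvd_add[OF assms[unfolded congr_def]] by (simp add: congr_def algebra_simps)

lemma congr_diff:
  assumes "congr M a b" and "congr M c d"
  shows "congr M (a - c) (b - d)"
  using dvd_diff[OF assms[unfolded congr_def]] by (simp add: congr_def algebra_simps)

lemma congr_mult:
  assumes "congr M a b" and "congr M c d"
  shows "congr M (a * c) (b * d)"
proof -
  have "a * c - b * d = (a - b) * c + b * (c - d)"
    by (simp add: algebra_simps)
  then show ?thesis
    using assms unfolding congr_def by simp
qed

lemma congr_power: "congr M a b \<Longrightarrow> congr M (a ^ n) (b ^ n)"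
  by (induction n) (auto intro: congr_mult congr_refl)

lemma congr_cancel_power:
  assumes "congr M (y * z) 1" and "congr M (y ^ n * a) (y ^ n * b)"
  shows "congr M a b"
proof -
  have inverse: "congr M ((y * z) ^ n * c) c" for c
    using congr_mult[OF congr_power[OF assms(1), of n] congr_refl[of M c]] by simp
  have "congr M (z ^ n * (y ^ n * a)) (z ^ n * (y ^ n * b))"
    by (rule congr_mult[OF congr_refl assms(2)])
  then have "congr M ((y * z) ^ n * a) ((y * z) ^ n * b)"
    by (simp add: power_mult_distrib mult_ac)
  then show ?thesis
    using inverse congr_sym congr_trans by blast
qed

section \<open>Dickson polynomials over a field\<close>

lemma reduce_Dickson_0: "reduce_poly (Dickson_poly 0) = ([:2:] :: 'a::field poly)"
  by (simp add: map_poly_pCons)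

lemma reduce_Dickson_1: "reduce_poly (Dickson_poly (Suc 0)) = ([:0, 1:] :: 'a::field poly)"
  by (simp add: map_poly_pCons)

lemma reduce_Dickson_rec:
  "reduce_poly (Dickson_poly (Suc (Suc n))) =
     [:0, 1:] * reduce_poly (Dickson_poly (Suc n)) - (reduce_poly (Dickson_poly n) :: 'a::field poly)"
  by (intro poly_eqI) (auto simp: coeff_map_poly coeff_pCons split: nat.splits)

text \<open>
  Index \<open>0\<close> is excluded because \<open>D\<^sub>0 = 2\<close> is not monic.
\<close>

lemma Dickson_degree_lead_coeff:
  "degree (reduce_poly (Dickson_poly (Suc n)) :: 'a::field poly) = Suc n \<and>
   lead_coeff (reduce_poly (Dickson_poly (Suc n)) :: 'a poly) = 1"
proof (induction n rule: less_induct)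
  case (less n)
  let ?d = "\<lambda>n. reduce_poly (Dickson_poly n) :: 'a poly"
  show ?case
  proof (cases n)
    case 0
    then show ?thesis by (simp add: reduce_Dickson_1 del: Dickson_poly.simps)
  next
    case (Suc k)
    have IH: "degree (?d (Suc k)) = Suc k" "lead_coeff (?d (Suc k)) = 1"
      using less.IH[of k] Suc by auto
    have nz: "?d (Suc k) \<noteq> 0"
      using IH(1) by force
    have low: "degree (?d k) < Suc (Suc k)"
    proof (cases k)
      case 0
      then show ?thesis by (simp add: reduce_Dickson_0 del: Dickson_poly.simps)
    next
      case (Suc j)
      then show ?thesis using less.IH[of j] \<open>n = Suc k\<close> by simp
    qed
    have shifted: "degree ([:0, 1:] * ?d (Suc k)) = Suc (Suc k)"
      using IH(1) nz by (simp del: Dickson_poly.simps)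
    have deg: "degree (?d (Suc (Suc k))) = Suc (Suc k)"
      unfolding reduce_Dickson_rec diff_conv_add_uminus
      using degree_add_eq_left[of "- ?d k" "[:0, 1:] * ?d (Suc k)"] low shifted by simp
    moreover have "coeff (?d (Suc (Suc k))) (Suc (Suc k)) = 1"
      unfolding reduce_Dickson_rec using IH low by (simp add: coeff_eq_0 del: Dickson_poly.simps)
    ultimately show ?thesis unfolding Suc by simp
  qed
qed

lemma Dickson_value_0:
  "poly (reduce_poly (Dickson_poly n)) (0 :: 'a::field) =
     (if odd n then 0 else 2 * (- 1) ^ (n div 2))"
proof (induction n rule: Dickson_poly.induct)
  case 1
  show ?case unfolding reduce_Dickson_0 by simp
next
  case 2
  show ?case unfolding reduce_Dickson_1 by simp
next
  case (3 n)
  have "poly (reduce_poly (Dickson_poly (Suc (Suc n)))) (0 :: 'a)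
      = - poly (reduce_poly (Dickson_poly n)) 0"
    unfolding reduce_Dickson_rec by simp
  then show ?case using 3(2) by (simp del: Dickson_poly.simps)
qed

text \<open>
  The functional equation \<open>D\<^sub>n(y + 1/y) = y^n + y^{-n}\<close>: the power sums \<open>y^n + z^n\<close> satisfy the
  recurrence \<open>s\<^sub>{n+2} = (y + z) s\<^sub>{n+1} - y z s\<^sub>n\<close>, which is that of Dickson once \<open>y z\<close> is \<open>1\<close>.
  It is stated modulo \<open>M\<close>, with the Dickson polynomial in \<open>x = y + z\<close> as a constant coefficient, so
  that an identity in \<open>x\<close> can later be read off from a congruence.
\<close>

lemma Dickson_congr_power_sum:
  fixes y z M :: "'a::field poly poly"
  assumes "congr M (y * z) 1" and "y + z = [:[:0, 1:]:]"
  shows "congr M [:reduce_poly (Dickson_poly n):] (y ^ n + z ^ n)"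
proof (induction n rule: Dickson_poly.induct)
  case 1
  have "[:reduce_poly (Dickson_poly 0) :: 'a poly:] = y ^ 0 + z ^ 0"
    unfolding reduce_Dickson_0 by (simp add: numeral_poly)
  then show ?case by (simp only: congr_refl)
next
  case 2
  show ?case unfolding reduce_Dickson_1 power_Suc0_right assms(2) by (rule congr_refl)
next
  case (3 n)
  let ?d = "\<lambda>n. [:reduce_poly (Dickson_poly n) :: 'a poly:]"
  have "?d (Suc (Suc n)) = (y + z) * ?d (Suc n) - ?d n"
    unfolding reduce_Dickson_rec assms(2) by simp
  also have "congr M \<dots> ((y + z) * (y ^ Suc n + z ^ Suc n) - 1 * (y ^ n + z ^ n))"
    unfolding mult_1 by (intro congr_diff congr_mult congr_refl 3)
  also have "congr M \<dots> ((y + z) * (y ^ Suc n + z ^ Suc n) - (y * z) * (y ^ n + z ^ n))"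
    by (intro congr_diff congr_mult congr_refl congr_sym[OF assms(1)])
  also have "\<dots> = y ^ Suc (Suc n) + z ^ Suc (Suc n)"
    by (simp add: algebra_simps)
  finally show ?case .
qed

section \<open>The square of the Dickson polynomial\<close>

text \<open>
  Modulo \<open>M\<close> the element \<open>z\<close> is the inverse of \<open>y\<close>, so the claim may be multiplied by \<open>y^h\<close>. This turns
  the left side into \<open>(y + 1)^{2h} \<plusminus> (y - 1)^{2h}\<close> with \<open>2 h = q + 1\<close>, and the Frobenius map
  expands both powers. What survives is \<open>2 (y^{q+1} + 1)\<close> for even \<open>h\<close> and \<open>2 (y^q + y)\<close> for
  odd \<open>h\<close>; this is where the choice of \<open>2 m\<close> comes from.
\<close>

lemma half_power_sum_congr:
  fixes y z :: "'r::comm_ring_1"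
  assumes inverse: "congr M (y * z) 1" and prime: "prime CHAR('r)" and q: "q = CHAR('r) ^ k"
    and odd: "odd q" and h: "2 * h = q + 1" and m: "2 * m = (if even h then h else h - 1)"
  shows "congr M ((2 + (y + z)) ^ h + (2 - (y + z)) ^ h) (2 * (y ^ (2 * m) + z ^ (2 * m)))"
proof -
  let ?s = "y + z"
  have plus: "congr M (y * (2 + ?s)) ((y + 1) ^ 2)"
    using inverse by (simp add: congr_def algebra_simps power2_eq_square)
  have "congr M (y * (2 - ?s)) (2 * y - y ^ 2 - y * z)"
    by (simp add: congr_def algebra_simps power2_eq_square)
  also have "congr M \<dots> (2 * y - y ^ 2 - 1)"
    by (intro congr_diff congr_refl inverse)
  also have "\<dots> = - ((y - 1) ^ 2)"
    by (simp add: algebra_simps power2_eq_square)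
  finally have minus: "congr M (y * (2 - ?s)) (- ((y - 1) ^ 2))" .
  have frob1: "(y + 1) ^ q = y ^ q + 1"
    using freshmans_dream'[OF prime q, of y 1] by simp
  have frob2: "(y - 1) ^ q = y ^ q - 1"
    using freshmans_dream'[OF prime q, of y "- 1"] odd by simp
  have powers: "((y + 1) ^ 2) ^ h = (y ^ q + 1) * (y + 1)" "((y - 1) ^ 2) ^ h = (y ^ q - 1) * (y - 1)"
    unfolding power_mult[symmetric] h power_add frob1 frob2 by simp_all
  have "y ^ h * ((2 + ?s) ^ h + (2 - ?s) ^ h) = (y * (2 + ?s)) ^ h + (y * (2 - ?s)) ^ h"
    unfolding power_mult_distrib by (rule distrib_left)
  also have "congr M \<dots> (((y + 1) ^ 2) ^ h + (- ((y - 1) ^ 2)) ^ h)"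
    by (intro congr_add congr_power plus minus)
  also have "\<dots> = (y ^ q + 1) * (y + 1) + (- 1) ^ h * ((y ^ q - 1) * (y - 1))"
    by (simp add: powers power_minus[of "(y - 1) ^ 2"])
  also have "congr M \<dots> (y ^ h * (2 * (y ^ (2 * m) + z ^ (2 * m))))"
  proof (cases "even h")
    case True
    then have mh: "2 * m = h" using m by simp
    have "(y ^ q + 1) * (y + 1) + (- 1) ^ h * ((y ^ q - 1) * (y - 1)) = 2 * (y ^ (2 * h) + 1)"
      unfolding h using True by (simp add: algebra_simps)
    also have "congr M \<dots> (2 * (y ^ (2 * h) + (y * z) ^ h))"
      using congr_sym[OF congr_power[OF inverse, of h]]
      by (intro congr_mult congr_add congr_refl) simp
    also have "\<dots> = y ^ h * (2 * (y ^ (2 * m) + z ^ (2 * m)))"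
      unfolding mh mult_2[of h] power_add by (simp add: algebra_simps)
    finally show ?thesis .
  next
    case False
    then obtain j where j: "h = Suc j" by (cases h) auto
    have qj: "q = Suc (j + j)" using h j by simp
    have mj: "2 * m = j" using m False j by simp
    have "(y ^ q + 1) * (y + 1) + (- 1) ^ h * ((y ^ q - 1) * (y - 1)) = 2 * (y ^ q + y * 1)"
      using False by (simp add: algebra_simps)
    also have "congr M \<dots> (2 * (y ^ q + y * (y * z) ^ j))"
      using congr_sym[OF congr_power[OF inverse, of j]]
      by (intro congr_mult congr_add congr_refl) simp
    also have "\<dots> = y ^ h * (2 * (y ^ (2 * m) + z ^ (2 * m)))"
      unfolding mj j qj by (simp add: algebra_simps power_add)
    finally show ?thesis .
  qed
  finally show ?thesis
    by (rule congr_cancel_power[OF inverse])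
qed

lemma Dickson_square:
  assumes prime: "prime CHAR('a::field)" and q: "q = CHAR('a) ^ k"
    and odd: "odd q" and h: "2 * h = q + 1" and m: "2 * m = (if even h then h else h - 1)"
  shows "2 * (reduce_poly (Dickson_poly m) :: 'a poly) ^ 2 = [:2, 1:] ^ h + [:2, - 1:] ^ h + 4"
proof -
  let ?P = "reduce_poly (Dickson_poly m) :: 'a poly"
  \<comment> \<open>Outer variable \<open>y\<close>, inner variable \<open>x\<close>: here \<open>z = x - y\<close> and \<open>M = y z - 1\<close>.\<close>
  define y z M :: "'a poly poly"
    where "y = [:0, 1:]" and "z = [:[:0, 1:], - 1:]" and "M = [:- 1, [:0, 1:], - 1:]"
  have sum: "y + z = [:[:0, 1:]:]"
    by (simp add: y_def z_def)
  have inverse: "congr M (y * z) 1"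
    by (simp add: congr_def y_def z_def M_def one_pCons)
  let ?c = "2 * ?P ^ 2 - ([:2, 1:] ^ h + [:2, - 1:] ^ h + 4)"
  have "[:2 * ?P ^ 2:] = 2 * [:?P:] ^ 2"
    by (simp add: poly_const_pow numeral_poly)
  also have "congr M \<dots> (2 * (y ^ m + z ^ m) ^ 2)"
    by (intro congr_mult congr_power congr_refl Dickson_congr_power_sum inverse sum)
  also have "\<dots> = 2 * (y ^ (2 * m) + z ^ (2 * m)) + 4 * (y * z) ^ m"
    unfolding mult_2[of m] power_add by (simp add: power2_eq_square algebra_simps)
  also have "congr M \<dots> (2 * (y ^ (2 * m) + z ^ (2 * m)) + 4 * 1 ^ m)"
    by (intro congr_add congr_mult congr_refl congr_power inverse)
  also have "congr M \<dots> ((2 + (y + z)) ^ h + (2 - (y + z)) ^ h + 4 * 1 ^ m)"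
    by (intro congr_add congr_refl congr_sym[OF half_power_sum_congr[OF inverse _ _ odd h m]])
       (use prime q in auto)
  also have "\<dots> = [:[:2, 1:] ^ h + [:2, - 1:] ^ h + 4:]"
    by (simp add: sum poly_const_pow numeral_poly one_pCons)
  finally have dvd: "M dvd [:?c:]"
    by (simp add: congr_def)
  \<comment> \<open>\<open>M\<close> has degree 2 in \<open>y\<close>, so it cannot divide a nonzero polynomial free of \<open>y\<close>.\<close>
  have "?c = 0"
  proof (rule ccontr)
    assume "?c \<noteq> 0"
    then have "degree M \<le> degree [:?c:]"
      using dvd by (intro dvd_imp_degree_le) auto
    then show False by (simp add: M_def)
  qed
  then show ?thesis by simp
qed

section \<open>Splitting into linear factors\<close>

text \<open>
  Splitting off one linear factor at a time avoids unique factorisation: a factor \<open>x - a\<close> is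
  cancelled from \<open>P\<close> if \<open>a\<close> is a root of \<open>P\<close>, and from the cofactor, twice, if it is not. Since the
  product on the right is squarefree, a root of \<open>P\<close> never has to be cancelled a second time.
\<close>

lemma square_dvd_prod_linear_square:
  fixes P :: "'a::field poly"
  assumes "finite F" and "P ^ 2 dvd (\<Prod>b\<in>F. [:- b, 1:]) ^ 2"
  shows "\<exists>c. P = smult c (\<Prod>b | b \<in> F \<and> poly P b = 0. [:- b, 1:])"
  using assms
proof (induction F arbitrary: P rule: finite_induct)
  case empty
  then have "P dvd 1" by (simp add: is_unit_power_iff)
  then obtain c where "P = [:c:]" by (auto simp: is_unit_poly_iff)
  then show ?case by auto
next
  case (insert a F)
  let ?L = "[:- a, 1:]" and ?W = "\<Prod>b\<in>F. [:- b, 1:]"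
  have dvd: "P ^ 2 dvd ?L ^ 2 * ?W ^ 2"
    using insert.prems unfolding prod.insert[OF insert.hyps] power_mult_distrib .
  show ?case
  proof (cases "poly P a = 0")
    case True
    then obtain P' where P': "P = ?L * P'"
      by (auto simp: poly_eq_0_iff_dvd)
    have "?L ^ 2 * P' ^ 2 dvd ?L ^ 2 * ?W ^ 2"
      using dvd by (simp only: P' power_mult_distrib)
    then have "P' ^ 2 dvd ?W ^ 2"
      by (subst (asm) dvd_mult_cancel_left) simp
    from insert.IH[OF this] obtain c where
      c: "P' = smult c (\<Prod>b | b \<in> F \<and> poly P' b = 0. [:- b, 1:])" by blast
    have "{b. b \<in> insert a F \<and> poly P b = 0} = insert a {b. b \<in> F \<and> poly P' b = 0}"
      using insert.hyps(2) by (auto simp: P')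
    then have roots: "(\<Prod>b | b \<in> insert a F \<and> poly P b = 0. [:- b, 1:])
        = ?L * (\<Prod>b | b \<in> F \<and> poly P' b = 0. [:- b, 1:])"
      using insert.hyps by simp
    have "P = ?L * smult c (\<Prod>b | b \<in> F \<and> poly P' b = 0. [:- b, 1:])"
      by (rule trans[OF P' arg_cong[OF c, of "(*) ?L"]])
    then have "P = smult c (\<Prod>b | b \<in> insert a F \<and> poly P b = 0. [:- b, 1:])"
      unfolding roots mult_smult_right .
    then show ?thesis by blast
  next
    case False
    have peel: "\<exists>K'. P ^ 2 * K' = V" if "P ^ 2 * K = ?L * V" for K V
    proof -
      have "poly (P ^ 2 * K) a = 0"
        unfolding that by simp
      then obtain K' where "K = ?L * K'"
        using False by (auto simp: poly_eq_0_iff_dvd)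
      then have "?L * (P ^ 2 * K') = ?L * V"
        using that by (simp only: mult_ac)
      then show ?thesis
        by (subst (asm) mult_cancel_left) auto
    qed
    obtain K where "?L ^ 2 * ?W ^ 2 = P ^ 2 * K"
      using dvd by (elim dvdE)
    then have "P ^ 2 * K = ?L * (?L * ?W ^ 2)"
      by (simp only: power2_eq_square mult.assoc)
    from peel[OF this] obtain K1 where "P ^ 2 * K1 = ?L * ?W ^ 2" by blast
    from peel[OF this] have "P ^ 2 dvd ?W ^ 2" by (metis dvd_triv_left)
    from insert.IH[OF this] obtain c where
      c: "P = smult c (\<Prod>b | b \<in> F \<and> poly P b = 0. [:- b, 1:])" by blast
    have "{b. b \<in> insert a F \<and> poly P b = 0} = {b. b \<in> F \<and> poly P b = 0}"
      using False by auto
    then show ?thesis using c by auto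
  qed
qed

lemma monom_card_minus_X:
  fixes q :: nat
  assumes q: "card (UNIV :: 'a::finite_field set) = q" and "q > 1"
  shows "[:0, 1:] ^ q - [:0, 1:] = (\<Prod>b\<in>(UNIV :: 'a set). [:- b, 1:])"
proof (rule poly_eqI_degree_lead_coeff[where A = UNIV and n = q])
  let ?X = "[:0, 1:] :: 'a poly" and ?W = "\<Prod>b\<in>(UNIV :: 'a set). [:- b, 1:]"
  have X: "?X ^ q = monom 1 q"
    by (simp add: monom_altdef)
  have degW: "degree ?W = q"
    using q by (subst degree_prod_sum_eq) auto
  show "coeff (?X ^ q - ?X) q = coeff ?W q"
    using lead_coeff_prod[of "\<lambda>b. [:- b, 1:] :: 'a poly" UNIV] degW \<open>q > 1\<close>
    by (simp add: X coeff_pCons split: nat.splits)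
  show "poly (?X ^ q - ?X) b = poly ?W b" if "b \<in> UNIV" for b
    using finite_field_power_card_eq_same[of b] q by (simp add: poly_prod)
  show "degree (?X ^ q - ?X) \<le> q"
    using \<open>q > 1\<close> by (intro degree_diff_le) (auto simp: X degree_monom_le)
qed (use degree_prod_sum_eq[of UNIV "\<lambda>b. [:- b, 1:] :: 'a poly"] q in auto)

text \<open>
  In the application \<open>A\<close> and \<open>B\<close> are \<open>(2 \<plusminus> x)^h\<close> and \<open>X = x^q\<close>. The product
  \<open>(A + B + 4)(A + B - 4)(A - B + 4)(A - B - 4)\<close> is invariant under changing the sign of \<open>A\<close> or \<open>B\<close>, so
  it is a polynomial in \<open>A^2\<close> and \<open>B^2\<close>, hence in \<open>x\<close> and \<open>X\<close>; it turns out to be \<open>16 (X - x)^2\<close>.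
\<close>

lemma square_dvd_of_quartic_norm:
  fixes A B x X P :: "'r::idom"
  assumes "A ^ 2 = (2 + x) * (2 + X)" and "B ^ 2 = (2 - x) * (2 - X)" and "2 * P ^ 2 = A + B + 4"
  shows "P ^ 2 dvd 16 * (X - x) ^ 2"
proof -
  have "16 * (X - x) ^ 2 = (A + B + 4) * ((A + B - 4) * ((A - B) ^ 2 - 16))"
    using assms(1,2) by algebra
  also have "\<dots> = P ^ 2 * (2 * ((A + B - 4) * ((A - B) ^ 2 - 16)))"
    unfolding assms(3)[symmetric] by (simp only: mult_ac)
  finally show ?thesis by simp
qed

section \<open>Quadratic residues in a finite field\<close>

text \<open>
  Translation by \<open>1\<close> permutes the field, so it leaves the sum of all elements unchanged, but it
  also adds the number of elements to that sum.
\<close>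

lemma CHAR_dvd_card_UNIV: "CHAR('a::finite_field) dvd card (UNIV :: 'a set)"
proof -
  have "(\<Sum>x\<in>(UNIV :: 'a set). x) = (\<Sum>x\<in>(UNIV :: 'a set). x + 1)"
    by (rule sum.reindex_bij_witness[of _ "\<lambda>x. x + 1" "\<lambda>x. x - 1"]) auto
  then have "(of_nat (card (UNIV :: 'a set)) :: 'a) = 0"
    by (simp add: sum.distrib)
  then show ?thesis
    by (simp add: of_nat_eq_0_iff_char_dvd)
qed

lemma two_neq_0:
  assumes "odd (card (UNIV :: 'a::finite_field set))"
  shows "(2 :: 'a) \<noteq> 0"
proof
  assume "(2 :: 'a) = 0"
  then have "CHAR('a) dvd 2"
    by (metis of_nat_eq_0_iff_char_dvd of_nat_numeral)
  then have "CHAR('a) = 2"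
    using CHAR_prime[where 'a = 'a] primes_dvd_imp_eq two_is_prime_nat by blast
  then show False
    using CHAR_dvd_card_UNIV[where 'a = 'a] assms by simp
qed

text \<open>
  Squaring is at most two-to-one on the nonzero elements.
\<close>

lemma card_squares_ge:
  "card (UNIV :: 'a::finite_field set) + 1 \<le> 2 * card {a :: 'a. is_square a}"
proof -
  let ?Q = "{a :: 'a. is_square a}"
  have "UNIV - {0} \<subseteq> (\<Union>s\<in>?Q - {0}. {x :: 'a. x ^ 2 = s})"
    by auto
  then have "card (UNIV - {0 :: 'a}) \<le> card (\<Union>s\<in>?Q - {0}. {x :: 'a. x ^ 2 = s})"
    by (intro card_mono) auto
  also have "\<dots> \<le> (\<Sum>s\<in>?Q - {0}. card {x :: 'a. x ^ 2 = s})"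
    by (intro card_UN_le) auto
  also have "\<dots> \<le> (\<Sum>s\<in>?Q - {0}. 2)"
  proof (intro sum_mono)
    fix s assume "s \<in> ?Q - {0}"
    then obtain c where "s = c ^ 2"
      by (auto elim: is_nth_powerE)
    then have "{x. x ^ 2 = s} \<subseteq> {c, - c}"
      by (auto simp: power2_eq_iff)
    then have "card {x. x ^ 2 = s} \<le> card {c, - c}"
      by (intro card_mono) auto
    also have "\<dots> \<le> 2"
      by (simp add: card_insert_if)
    finally show "card {x. x ^ 2 = s} \<le> 2" .
  qed
  also have "\<dots> = 2 * (card ?Q - 1)"
    by (simp add: card_Diff_singleton)
  finally have "card (UNIV :: 'a set) - 1 \<le> 2 * (card ?Q - 1)"
    by (simp add: card_Diff_singleton)
  moreover have "card ?Q > 0"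
    by (subst card_gt_0_iff) (auto intro: exI[of _ 0])
  ultimately show ?thesis by linarith
qed

text \<open>
  Euler's criterion multiplied by \<open>a\<close>, so that \<open>a = 0\<close> needs no separate treatment. All squares
  are roots of \<open>x^h - x\<close>, and there are at least \<open>h\<close> of them, so this polynomial has no other roots;
  a nonsquare \<open>a\<close> therefore satisfies \<open>a^h \<noteq> a\<close>, which leaves only \<open>a^h = - a\<close>.
\<close>

lemma Euler_criterion_finite_field:
  fixes a :: "'a::finite_field"
  assumes q: "card (UNIV :: 'a set) = q" and odd: "odd q" and h: "2 * h = q + 1"
  shows "a ^ h = a * of_int (finite_Legendre a)"
proof -
  have frob: "x ^ q = x" for x :: 'a
    using finite_field_power_card_eq_same[of x] q by simp
  have square: "a ^ h = a" if "is_square a" for a :: 'a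
  proof -
    obtain c where c: "a = c ^ 2"
      using \<open>is_square a\<close> by (auto elim: is_nth_powerE)
    have "a ^ h = c ^ (q + 1)"
      by (simp only: c power_mult[symmetric] h)
    then show ?thesis by (simp add: frob c power2_eq_square)
  qed
  have "card {0, 1 :: 'a} \<le> q"
    unfolding q[symmetric] by (intro card_mono) auto
  then have "h > 1"
    using h by simp
  define p :: "'a poly" where "p = monom 1 h - [:0, 1:]"
  have poly_p: "poly p x = x ^ h - x" for x
    by (simp add: p_def poly_monom)
  have degp: "degree p \<le> h"
    unfolding p_def using \<open>h > 1\<close> by (intro degree_diff_le) (auto simp: degree_monom_le)
  have "coeff p h = 1"
    using \<open>h > 1\<close> by (simp add: p_def coeff_pCons split: nat.splits)
  then have nz: "p \<noteq> 0" by auto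
  let ?R = "{x. poly p x = 0}" and ?Q = "{x :: 'a. is_square x}"
  have "card ?R \<le> h"
    using card_poly_roots_bound[OF nz] degp by linarith
  moreover have "h \<le> card ?Q"
    using card_squares_ge[where 'a = 'a] q h by simp
  moreover have "?Q \<subseteq> ?R"
    using square by (auto simp: poly_p)
  moreover have "finite ?R" by simp
  ultimately have eq: "?Q = ?R"
    by (metis card_subset_eq card_mono le_antisym le_trans)
  show ?thesis
  proof (cases "is_square a")
    case True
    then show ?thesis using square by (simp add: finite_Legendre_def)
  next
    case False
    then have "a ^ h \<noteq> a" using eq poly_p by auto
    moreover have "(a ^ h) ^ 2 = a ^ 2"
      unfolding power_mult[symmetric] mult.commute[of h 2] h power_add frob
      by (simp add: power2_eq_square)
    ultimately have "a ^ h = - a" by (auto simp: power2_eq_iff)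
    moreover have "a \<noteq> 0" using False by auto
    ultimately show ?thesis using False by (simp add: finite_Legendre_def)
  qed
qed

section \<open>The factorisation\<close>

theorem theorem2p1:
  fixes q m :: nat and \<epsilon> :: int
  assumes "primepow q" and "odd q" and "card (UNIV :: 'a::finite_field set) = q"
    and "\<epsilon> = (- 1) ^ ((q - 1) div 2)"
    and "m = nat ((int q - \<epsilon>) div 4)"
  shows "4 dvd int q - \<epsilon> \<and>
    (reduce_poly (Dickson_poly m) :: 'a poly) =
      (\<Prod>b | finite_Legendre (2 - b) = - 1 \<and> finite_Legendre (2 + b) = - 1. [:- b, 1:]) \<and>
    (reduce_poly (Dickson_poly m) :: 'a poly) =
      smult (of_int (finite_Legendre (2 :: 'a)))
        (\<Prod>b | finite_Legendre (2 - b) = - 1 \<and> finite_Legendre (2 + b) = - 1. [:b, - 1:])"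
proof -
  let ?P = "reduce_poly (Dickson_poly m) :: 'a poly"
  let ?chi = "finite_Legendre :: 'a \<Rightarrow> int"
  let ?S = "{b :: 'a. ?chi (2 - b) = - 1 \<and> ?chi (2 + b) = - 1}"
  note card = assms(3)
  have two: "(2 :: 'a) \<noteq> 0"
    using two_neq_0[where 'a = 'a] assms(2) card by simp
  have four: "(4 :: 'a) \<noteq> 0" and eight: "(8 :: 'a) \<noteq> 0" and sixteen: "(16 :: 'a) \<noteq> 0"
    using power_not_zero[OF two, of 2] power_not_zero[OF two, of 3] power_not_zero[OF two, of 4]
    by simp_all
  have "card {0, 1 :: 'a} \<le> q"
    unfolding card[symmetric] by (intro card_mono) auto
  then have "q > 1" by simp
  define h where "h = (q + 1) div 2"
  have h: "2 * h = q + 1"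
    using assms(2) by (simp add: h_def)

  have indices: "4 dvd int q - \<epsilon> \<and> 2 * m = (if even h then h else h - 1)"
  proof (cases "even h")
    case True
    then obtain j where j: "h = 2 * j" by (elim evenE)
    then have half: "(q - 1) div 2 = 2 * (j - 1) + 1" and "int q = 4 * int j - 1"
      using h \<open>q > 1\<close> by auto
    moreover have "\<epsilon> = - 1"
      unfolding assms(4) half by simp
    ultimately have "int q - \<epsilon> = 4 * int j" by simp
    then show ?thesis using assms(5) j True by simp
  next
    case False
    then obtain j where j: "h = 2 * j + 1" by (elim oddE)
    then have half: "(q - 1) div 2 = 2 * j" and "int q = 4 * int j + 1"
      using h by auto
    moreover have "\<epsilon> = 1"
      unfolding assms(4) half by simp
    ultimately have "int q - \<epsilon> = 4 * int j" by simp
    then show ?thesis using assms(5) j False by simp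
  qed
  then have m: "2 * m = (if even h then h else h - 1)" by blast
  have "h > 1"
    using h \<open>q > 1\<close> by linarith
  then obtain j where j: "m = Suc j"
    using m by (cases m) (auto split: if_splits)
  have degP: "degree ?P = m" and leadP: "lead_coeff ?P = 1"
    using Dickson_degree_lead_coeff[of j, where 'a = 'a] unfolding j by blast+

  obtain p k where pk: "prime p" "q = p ^ k"
    using assms(1) by (auto simp: primepow_def)
  have "CHAR('a) dvd q"
    using CHAR_dvd_card_UNIV[where 'a = 'a] card by simp
  then have "CHAR('a) = p"
    using pk CHAR_prime[where 'a = 'a] prime_dvd_power primes_dvd_imp_eq by metis
  then have prime: "prime CHAR('a)" and q: "q = CHAR('a) ^ k"
    using pk by simp_all

  let ?A = "[:2, 1:] ^ h :: 'a poly" and ?B = "[:2, - 1:] ^ h :: 'a poly"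
  have square: "2 * ?P ^ 2 = ?A + ?B + 4"
    by (rule Dickson_square[OF prime q assms(2) h m])

  have value_at: "2 * poly ?P b ^ 2 = (2 + b) * of_int (?chi (2 + b)) + (2 - b) * of_int (?chi (2 - b)) + 4"
    for b
  proof -
    have "2 * poly ?P b ^ 2 = poly (2 * ?P ^ 2) b"
      by simp
    also have "\<dots> = (2 + b) ^ h + (2 - b) ^ h + 4"
      unfolding square by simp
    finally show ?thesis
      unfolding Euler_criterion_finite_field[OF card assms(2) h] .
  qed

  \<comment> \<open>For \<open>b = \<plusminus>2\<close> the value in \<open>value_at\<close> is \<open>8\<close>. Otherwise both symbols are \<open>\<plusminus>1\<close>, and it is \<open>8\<close>,
    \<open>2 (2 + b)\<close>, \<open>2 (2 - b)\<close> or \<open>0\<close>; only two symbols \<open>-1\<close> give \<open>0\<close>.\<close>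
  have roots: "poly ?P b = 0 \<longleftrightarrow> b \<in> ?S" for b
  proof -
    have "poly ?P b = 0 \<longleftrightarrow> 2 * poly ?P b ^ 2 = 0"
      using two by simp
    also have "\<dots> \<longleftrightarrow> b \<in> ?S"
    proof -
      have zero: "?chi x = 0 \<longleftrightarrow> x = 0" for x
        by (simp add: finite_Legendre_def)
      have cases: "?chi x = - 1 \<or> ?chi x = 0 \<or> ?chi x = 1" for x
        by (simp add: finite_Legendre_def)
      have chi4: "?chi 4 = 1"
        using four is_nth_power_nth_power[of 2 "2 :: 'a"] by (simp add: finite_Legendre_def)
      consider "b = 2" | "b = - 2" | "2 - b \<noteq> 0" "2 + b \<noteq> 0"
        by (metis add_eq_0_iff eq_iff_diff_eq_0)
      then show ?thesis
      proof cases
        case 3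
        consider "?chi (2 + b) = 1" "?chi (2 - b) = 1" | "?chi (2 + b) = 1" "?chi (2 - b) = - 1"
          | "?chi (2 + b) = - 1" "?chi (2 - b) = 1" | "?chi (2 + b) = - 1" "?chi (2 - b) = - 1"
          using cases[of "2 + b"] cases[of "2 - b"] zero[of "2 + b"] zero[of "2 - b"] 3 by blast
        then show ?thesis
        proof cases
          case 1
          then show ?thesis using value_at[of b] eight by simp
        next
          case 2
          then have "2 * poly ?P b ^ 2 = 2 * (2 + b)"
            using value_at[of b] by simp
          then have "2 * poly ?P b ^ 2 \<noteq> 0"
            using no_zero_divisors[OF two \<open>2 + b \<noteq> 0\<close>] by (simp only:) simp
          then show ?thesis using 2 by simp
        next
          case 3
          then have "2 * poly ?P b ^ 2 = 2 * (2 - b)"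
            using value_at[of b] by simp
          then have "2 * poly ?P b ^ 2 \<noteq> 0"
            using no_zero_divisors[OF two \<open>2 - b \<noteq> 0\<close>] by (simp only:) simp
          then show ?thesis using 3 by simp
        next
          case 4
          then show ?thesis using value_at[of b] by simp
        qed
      qed (use value_at[of b] chi4 eight zero in \<open>simp_all add: zero\<close>)
    qed
    finally show ?thesis .
  qed

  have factorisation: "?P = (\<Prod>b\<in>?S. [:- b, 1:])"
  proof -
    let ?x = "[:0, 1:] :: 'a poly"
    have frob: "(2 + u) ^ q = 2 + u ^ q" for u :: "'a poly"
    proof -
      have "(2 :: 'a poly) ^ q = [:2 ^ q:]"
        by (simp add: numeral_poly poly_const_pow)
      also have "\<dots> = 2"
        using finite_field_power_card_eq_same[of "2 :: 'a"] card by (simp add: numeral_poly)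
      finally show ?thesis
        using freshmans_dream'[of q k 2 u] prime q by simp
    qed
    have lin: "[:2, 1:] = 2 + ?x" "[:2, - 1:] = 2 + - ?x"
      by (simp_all add: numeral_poly)
    have dbl: "(u ^ h) ^ 2 = u * u ^ q" for u :: "'a poly"
      by (simp add: power_mult[symmetric] mult.commute[of h 2] h)
    have "?A ^ 2 = (2 + ?x) * (2 + ?x ^ q)" "?B ^ 2 = (2 - ?x) * (2 - ?x ^ q)"
      unfolding dbl lin frob power_minus_odd[OF assms(2)] by simp_all
    then have "?P ^ 2 dvd 16 * (?x ^ q - ?x) ^ 2"
      using square by (rule square_dvd_of_quartic_norm)
    also have "16 * (?x ^ q - ?x) ^ 2 = smult 16 ((?x ^ q - ?x) ^ 2)"
      by (simp add: numeral_poly)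
    finally have "?P ^ 2 dvd (?x ^ q - ?x) ^ 2"
      using sixteen by (rule dvd_smult_cancel)
    then have "?P ^ 2 dvd (\<Prod>b\<in>(UNIV :: 'a set). [:- b, 1:]) ^ 2"
      unfolding monom_card_minus_X[OF card \<open>q > 1\<close>] .
    then obtain c where c: "?P = smult c (\<Prod>b | b \<in> UNIV \<and> poly ?P b = 0. [:- b, 1:])"
      using square_dvd_prod_linear_square[of UNIV ?P] by auto
    then have P: "?P = smult c (\<Prod>b\<in>?S. [:- b, 1:])"
      unfolding roots by simp
    have "lead_coeff (smult c (\<Prod>b\<in>?S. [:- b, 1:])) = c"
      by (simp only: lead_coeff_smult lead_coeff_prod) simp
    then have "c = 1"
      using leadP unfolding P[symmetric] by simp
    then show ?thesis using P by simp
  qed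

  have degree: "card ?S = m"
  proof -
    have "degree (\<Prod>b\<in>?S. [:- b, 1:]) = card ?S"
      by (subst degree_prod_sum_eq) auto
    then show ?thesis using degP unfolding factorisation[symmetric] by simp
  qed

  \<comment> \<open>At \<open>b = 0\<close> the identity reads \<open>2 D(0)^2 = 4 \<chi>(2) + 4\<close>, where \<open>D(0)^2\<close> is \<open>4\<close> for even \<open>m\<close> and
    \<open>0\<close> for odd \<open>m\<close>.\<close>
  have supplement: "(of_int (?chi 2) :: 'a) = (- 1) ^ m"
  proof -
    have "4 * of_int (?chi 2) = 2 * poly ?P 0 ^ 2 - 4"
      using value_at[of 0] by (simp add: algebra_simps)
    also have "\<dots> = 4 * (- 1) ^ m"
      by (simp add: Dickson_value_0 power_mult_distrib power_mult[symmetric])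
    finally show ?thesis using four by simp
  qed

  have "(\<Prod>b\<in>?S. [:b, - 1:]) = (\<Prod>b\<in>?S. smult (- 1) [:- b, 1:])"
    by simp
  also have "\<dots> = smult ((- 1) ^ m) ?P"
    unfolding prod_smult factorisation by (simp add: degree)
  finally have "smult (of_int (?chi 2)) (\<Prod>b\<in>?S. [:b, - 1:]) = ?P"
    by (simp add: supplement flip: power_mult_distrib)
  then show ?thesis
    using indices factorisation by simp
qed

end
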